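(* Let $U_1,\dots,U_m$ be finitely many closed convex subsets of $\mathbb{R}^n$ with $S:=\bigcap_{i=1}^m U_i\neq\varnothing$. Suppose that $T:\mathbb{R}^n\to\mathbb{R}^n$ satisfies, for some constant $c_0>0$, $$\|Tx-s\|^2\le\|x-s\|^2-c_0\,\delta(x)^2\qquad\text{for all } s\in S \text{ and all } x\in\mathbb{R}^n .$$ Let $(\alpha_k)_{k\ge0}\subset[0,1]$ satisfy $\alpha_k\to0$ and $\sum_k\alpha_k=\infty$. Given $x\in\mathbb{R}^n$, define the sequence $(x_k)_{k\ge 0}$ by $x_0=x$ and $$x_{k+1}=\alpha_k x+(1-\alpha_k)\,Tx_k,\qquad k\ge0 .$$ Then $x_k\to P_S(x)$.
   Context: $\mathbb{R}^n$ is Euclidean space with inner product $\langle\cdot,\cdot\rangle$ and associated norm $\|\cdot\|$. $\delta(z):=\max_{1\le i\le m}\mathrm{dist}(z,U_i)$ is the maximal constraint violation. $P_S(x)$ is the metric projection of $x$ onto $S$, i.e. the unique minimizer of $\|y-x\|$ over $y\in S$. *)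

theory Defs
  imports "HOL-Analysis.Analysis"
begin

(* The maximum is meaningful for 1 <= m. Note that infdist z {} = 0 in the library, so this
   is the maximal distance only when all the sets U i are nonempty. *)
definition max_violation :: "nat \<Rightarrow> (nat \<Rightarrow> 'a::metric_space set) \<Rightarrow> 'a \<Rightarrow> real" where
  "max_violation m U z = Max ((\<lambda>i. infdist z (U i)) ` {1..m})"

end

theory Submission
  imports Defs
begin

text \<open>
  Write \<open>p\<close> for the projection of \<open>x\<close> onto \<open>S\<close>, \<open>a\<^sub>k = \<parallel>x\<^sub>k - p\<parallel>\<^sup>2\<close>,
  \<open>r = \<parallel>x - p\<parallel>\<close> and \<open>\<delta>\<^sub>k\<close> for the violation at \<open>x\<^sub>k\<close>.  Expanding the square of
  \<open>x\<^sub>k\<^sub>+\<^sub>1 - p = \<alpha>\<^sub>k (x - p) + (1 - \<alpha>\<^sub>k) (T x\<^sub>k - p)\<close> leaves, besides \<open>(1 - \<alpha>\<^sub>k) a\<^sub>k\<close>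
  and the harmless \<open>\<alpha>\<^sub>k\<^sup>2 r\<^sup>2\<close>, two terms: the gain
  \<open>- (1 - \<alpha>\<^sub>k) c\<^sub>0 \<delta>\<^sub>k\<^sup>2\<close> supplied by \<open>T\<close>, and the cross term
  \<open>2 \<alpha>\<^sub>k (1 - \<alpha>\<^sub>k) \<langle>x - p, T x\<^sub>k - p\<rangle>\<close>.

  The inner product is at most \<open>r dist(x\<^sub>k, S)\<close>: it would be nonpositive with a point of \<open>S\<close> in place
  of \<open>T x\<^sub>k\<close>, and \<open>T\<close> does not move \<open>x\<^sub>k\<close> away from its nearest point in \<open>S\<close>
  (\<open>inner_closest_point_le_infdist\<close>).  The iterates stay in the ball of radius \<open>r\<close> around \<open>p\<close>,
  and by compactness \<open>dist(z, S) \<le> \<epsilon> + K \<delta>(z)\<^sup>2\<close> on that ball, for every \<open>\<epsilon> > 0\<close> with a constant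
  \<open>K\<close> depending on \<open>\<epsilon>\<close> (\<open>infdist_Inter_le_max_violation_square\<close>).  The part of the cross term with
  \<open>\<delta>\<^sub>k\<^sup>2\<close> carries an extra factor \<open>\<alpha>\<^sub>k\<close>, which tends to zero, so the gain eventually absorbs it,
  however large \<open>K\<close> is.  What remains is \<open>a\<^sub>k\<^sub>+\<^sub>1 \<le> (1 - \<alpha>\<^sub>k) a\<^sub>k + \<alpha>\<^sub>k \<epsilon>'\<close>
  for all large \<open>k\<close>, with \<open>\<epsilon>'\<close> arbitrarily small, and divergence of the sum of the \<open>\<alpha>\<^sub>k\<close>
  drives \<open>a\<^sub>k\<close> below any number exceeding \<open>\<epsilon>'\<close> (\<open>contracting_recursion_eventually_small\<close>).
\<close>

text \<open>
  The excess of \<open>u\<close> over \<open>\<epsilon>\<close> shrinks by the factor \<open>1 - \<alpha> k \<le> exp (- \<alpha> k)\<close> in each step, hence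
  like the exponential of minus the partial sums of \<open>\<alpha>\<close>.
\<close>

lemma contracting_recursion_eventually_small:
  fixes u \<alpha> :: "nat \<Rightarrow> real"
  assumes \<alpha>: "\<And>k. \<alpha> k \<in> {0..1}"
    and div: "filterlim (\<lambda>N. \<Sum>k<N. \<alpha> k) at_top sequentially"
    and rec: "\<forall>\<^sub>F k in sequentially. u (Suc k) \<le> (1 - \<alpha> k) * u k + \<alpha> k * \<epsilon>"
    and "\<epsilon> < \<epsilon>'"
  shows "\<forall>\<^sub>F k in sequentially. u k < \<epsilon>'"
proof -
  define s where "s k = (\<Sum>i<k. \<alpha> i)" for k
  obtain N where N: "\<And>k. k \<ge> N \<Longrightarrow> u (Suc k) \<le> (1 - \<alpha> k) * u k + \<alpha> k * \<epsilon>"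
    using rec by (auto simp: eventually_sequentially)
  define W where "W = max 0 (u N - \<epsilon>) * exp (s N)"
  have "W \<ge> 0" by (simp add: W_def)
  have bound: "u k - \<epsilon> \<le> W * exp (- s k)" if "k \<ge> N" for k
    using that
  proof (induction k rule: dec_induct)
    case base
    then show ?case by (simp add: W_def mult.assoc flip: exp_add)
  next
    case (step k)
    have "u (Suc k) - \<epsilon> \<le> (1 - \<alpha> k) * (u k - \<epsilon>)"
      using N[OF step.hyps(1)] by (simp add: algebra_simps)
    also have "\<dots> \<le> (1 - \<alpha> k) * (W * exp (- s k))"
      using step.IH \<alpha>[of k] by (intro mult_left_mono) auto
    also have "\<dots> \<le> exp (- \<alpha> k) * (W * exp (- s k))"
      using exp_ge_add_one_self[of "- \<alpha> k"] \<open>W \<ge> 0\<close> by (intro mult_right_mono) auto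
    also have "\<dots> = W * exp (- s (Suc k))"
      by (simp add: s_def exp_diff exp_minus divide_simps exp_add)
    finally show ?case .
  qed
  have "((\<lambda>k. exp (- s k)) \<longlongrightarrow> 0) sequentially"
    using div unfolding s_def
    by (intro filterlim_compose[OF exp_at_bot]) (simp add: filterlim_uminus_at_top)
  then have "((\<lambda>k. W * exp (- s k)) \<longlongrightarrow> 0) sequentially"
    by (rule tendsto_mult_right_zero)
  then have "\<forall>\<^sub>F k in sequentially. W * exp (- s k) < \<epsilon>' - \<epsilon>"
    using \<open>\<epsilon> < \<epsilon>'\<close> by (intro order_tendstoD(2)) auto
  then show ?thesis
    using eventually_ge_at_top[of N] by eventually_elim (use bound in force)
qed

text \<open>
  Where \<open>g \<ge> \<epsilon>\<close>, the function \<open>f\<close> has no zeros, so \<open>g / f\<^sup>2\<close> is bounded there by compactness.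
\<close>

lemma compact_bound_by_square:
  fixes f g :: "'a::t2_space \<Rightarrow> real"
  assumes "compact C" and f: "continuous_on C f" and g: "continuous_on C g"
    and zero: "\<And>z. z \<in> C \<Longrightarrow> f z = 0 \<Longrightarrow> g z \<le> 0"
    and "0 < \<epsilon>"
  obtains K where "0 \<le> K" and "\<And>z. z \<in> C \<Longrightarrow> g z \<le> \<epsilon> + K * (f z)\<^sup>2"
proof -
  define C' where "C' = C \<inter> g -` {\<epsilon>..}"
  have "closedin (top_of_set C) C'"
    unfolding C'_def by (intro continuous_closedin_preimage[OF g]) simp
  then have "compact C'"
    using \<open>compact C\<close> by (rule closedin_compact[rotated])
  have nz: "f z \<noteq> 0" if "z \<in> C'" for z
    using zero[of z] that \<open>0 < \<epsilon>\<close> by (force simp: C'_def)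
  have "continuous_on C' (\<lambda>z. g z / (f z)\<^sup>2)"
    by (intro continuous_intros continuous_on_subset[OF f] continuous_on_subset[OF g])
      (auto simp: nz, auto simp: C'_def)
  then have "bounded ((\<lambda>z. g z / (f z)\<^sup>2) ` C')"
    using \<open>compact C'\<close> by (intro compact_imp_bounded compact_continuous_image)
  then obtain K where K: "\<And>z. z \<in> C' \<Longrightarrow> \<bar>g z / (f z)\<^sup>2\<bar> \<le> K" and "0 < K"
    by (auto simp: bounded_pos)
  have "g z \<le> \<epsilon> + K * (f z)\<^sup>2" if "z \<in> C" for z
  proof (cases "\<epsilon> \<le> g z")
    case True
    then have "z \<in> C'" using that by (simp add: C'_def)
    then have "g z / (f z)\<^sup>2 \<le> K" and "0 < (f z)\<^sup>2"
      using abs_le_D1[OF K[OF \<open>z \<in> C'\<close>]] nz[OF \<open>z \<in> C'\<close>] by auto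
    then show ?thesis using \<open>0 < \<epsilon>\<close> by (simp add: divide_simps split: if_splits)
  next
    case False
    then show ?thesis using \<open>0 < K\<close> by (simp add: add_increasing2)
  qed
  with \<open>0 < K\<close> show ?thesis by (intro that[of K]) auto
qed

text \<open>
  This bound takes the place of a linear regularity assumption on the sets: finitely many closed
  sets need not satisfy \<open>dist(z, S) \<le> K \<delta>(z)\<close> locally, but an additive error \<open>\<epsilon>\<close>
  makes compactness sufficient.
\<close>

lemma infdist_Inter_le_max_violation_square:
  fixes U :: "nat \<Rightarrow> 'a::heine_borel set"
  assumes closed: "\<And>i. i \<in> {1..m} \<Longrightarrow> closed (U i)"
    and S: "S = (\<Inter>i\<in>{1..m}. U i)" and "S \<noteq> {}"
    and "bounded B" and "0 < \<epsilon>"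
  obtains K where "0 \<le> K"
    and "\<And>z. z \<in> B \<Longrightarrow> infdist z S \<le> \<epsilon> + K * (max_violation m U z)\<^sup>2"
proof -
  \<comment> \<open>The sum of the distances is comparable to their maximum and is visibly continuous.\<close>
  define f where "f z = (\<Sum>i=1..m. infdist z (U i))" for z
  have "infdist z S \<le> 0" if "f z = 0" for z
  proof -
    have "infdist z (U i) = 0" if "i \<in> {1..m}" for i
      using \<open>f z = 0\<close> that by (simp add: f_def sum_nonneg_eq_0_iff infdist_nonneg)
    moreover have "U i \<noteq> {}" if "i \<in> {1..m}" for i
      using that \<open>S \<noteq> {}\<close> S by auto
    ultimately have "z \<in> S"
      using closed unfolding S by (auto simp: in_closed_iff_infdist_zero)
    then show ?thesis by simp
  qed
  moreover have "continuous_on (closure B) f" "continuous_on (closure B) (\<lambda>z. infdist z S)"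
    unfolding f_def by (intro continuous_intros)+
  moreover have "compact (closure B)"
    using \<open>bounded B\<close> by (simp add: compact_closure)
  ultimately obtain K where "0 \<le> K"
    and K: "\<And>z. z \<in> closure B \<Longrightarrow> infdist z S \<le> \<epsilon> + K * (f z)\<^sup>2"
    using compact_bound_by_square[of "closure B" f "\<lambda>z. infdist z S" \<epsilon>] \<open>0 < \<epsilon>\<close> by metis
  have "infdist z S \<le> \<epsilon> + K * (real m)\<^sup>2 * (max_violation m U z)\<^sup>2" if "z \<in> B" for z
  proof -
    have "infdist z (U i) \<le> max_violation m U z" if "i \<in> {1..m}" for i
      using that unfolding max_violation_def by (intro Max_ge) auto
    then have "f z \<le> real m * max_violation m U z"
      unfolding f_def using sum_bounded_above[of "{1..m}" "\<lambda>i. infdist z (U i)"] by simp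
    moreover have "0 \<le> f z" by (simp add: f_def sum_nonneg infdist_nonneg)
    ultimately have "(f z)\<^sup>2 \<le> (real m)\<^sup>2 * (max_violation m U z)\<^sup>2"
      by (metis power_mono power_mult_distrib)
    then have "K * (f z)\<^sup>2 \<le> K * (real m)\<^sup>2 * (max_violation m U z)\<^sup>2"
      using \<open>0 \<le> K\<close> by (simp add: mult.assoc mult_left_mono)
    moreover have "infdist z S \<le> \<epsilon> + K * (f z)\<^sup>2"
      using K that closure_subset by blast
    ultimately show ?thesis by linarith
  qed
  with \<open>0 \<le> K\<close> show ?thesis by (intro that[of "K * (real m)\<^sup>2"]) auto
qed

text \<open>
  The point \<open>y\<close> plays the role of the image of \<open>z\<close> under a quasi-nonexpansive map.  It is compared
  with the point \<open>s\<close> of \<open>S\<close> nearest to \<open>z\<close>: with \<open>s\<close> in place of \<open>y\<close> the inner product is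
  nonpositive by the obtuse-angle property of the projection, and the difference is controlled by
  \<open>\<parallel>y - s\<parallel> \<le> \<parallel>z - s\<parallel> = dist(z, S)\<close>.
\<close>

lemma inner_closest_point_le_infdist:
  fixes x y z :: "'a::euclidean_space"
  assumes "closed S" "convex S" "S \<noteq> {}"
    and fejer: "\<And>s. s \<in> S \<Longrightarrow> norm (y - s) \<le> norm (z - s)"
  shows "(x - closest_point S x) \<bullet> (y - closest_point S x)
    \<le> norm (x - closest_point S x) * infdist z S"
proof -
  define p where "p = closest_point S x"
  obtain s where "s \<in> S" and s: "infdist z S = dist z s"
    using infdist_attains_inf[OF \<open>closed S\<close> \<open>S \<noteq> {}\<close>] by metis
  have "(x - p) \<bullet> (y - p) = (x - p) \<bullet> (s - p) + (x - p) \<bullet> (y - s)"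
    by (simp add: inner_diff_right)
  also have "\<dots> \<le> 0 + norm (x - p) * norm (y - s)"
    using closest_point_dot[OF \<open>convex S\<close> \<open>closed S\<close> \<open>s \<in> S\<close>, of x]
    by (intro add_mono norm_cauchy_schwarz) (simp add: p_def)
  also have "\<dots> \<le> norm (x - p) * infdist z S"
    using fejer[OF \<open>s \<in> S\<close>] s by (simp add: dist_norm mult_left_mono)
  finally show ?thesis by (simp add: p_def)
qed

theorem theorem3p3:
  fixes m :: nat
    and U :: "nat \<Rightarrow> (real ^ 'n) set"
    and S :: "(real ^ 'n) set"
    and T :: "real ^ 'n \<Rightarrow> real ^ 'n"
    and c\<^sub>0 :: real
    and \<alpha> :: "nat \<Rightarrow> real"
    and x :: "real ^ 'n"
    and xs :: "nat \<Rightarrow> real ^ 'n"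
  assumes "1 \<le> m"
    and "\<And>i. i \<in> {1..m} \<Longrightarrow> closed (U i)"
    and "\<And>i. i \<in> {1..m} \<Longrightarrow> convex (U i)"
    and "S = (\<Inter>i\<in>{1..m}. U i)"
    and "S \<noteq> {}"
    and "0 < c\<^sub>0"
    and "\<And>s y. s \<in> S \<Longrightarrow>
          (norm (T y - s))\<^sup>2 \<le> (norm (y - s))\<^sup>2 - c\<^sub>0 * (max_violation m U y)\<^sup>2"
    and "\<And>k. \<alpha> k \<in> {0..1}"
    and "\<alpha> \<longlonglongrightarrow> 0"
    and "filterlim (\<lambda>N. \<Sum>k<N. \<alpha> k) at_top sequentially"
    and "xs 0 = x"
    and "\<And>k. xs (Suc k) = \<alpha> k *\<^sub>R x + (1 - \<alpha> k) *\<^sub>R T (xs k)"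
  shows "xs \<longlonglongrightarrow> closest_point S x"
proof -
  define p where "p = closest_point S x"
  define \<delta> where "\<delta> k = max_violation m U (xs k)" for k
  define r where "r = norm (x - p)"
  note fejer2 = assms(7)
  have \<alpha>01: "0 \<le> \<alpha> k" "\<alpha> k \<le> 1" for k
    using assms(8)[of k] by auto
  have "closed S" "convex S"
    using assms(2-4) by (auto intro!: closed_INT convex_INT)
  then have "p \<in> S"
    using assms(5) by (simp add: p_def closest_point_in_set)
  have fejer: "norm (T y - s) \<le> norm (y - s)" if "s \<in> S" for s y
  proof (rule power2_le_imp_le)
    have "0 \<le> c\<^sub>0 * (max_violation m U y)\<^sup>2" using assms(6) by simp
    then show "(norm (T y - s))\<^sup>2 \<le> (norm (y - s))\<^sup>2"
      using fejer2[OF that, of y] by linarith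
  qed simp
  have split: "xs (Suc k) - p = \<alpha> k *\<^sub>R (x - p) + (1 - \<alpha> k) *\<^sub>R (T (xs k) - p)" for k
    by (simp add: assms(12) algebra_simps)
  have "norm (xs k - p) \<le> r" for k
  proof (induction k)
    case 0
    then show ?case by (simp add: assms(11) r_def)
  next
    case (Suc k)
    have "norm (xs (Suc k) - p) \<le> \<alpha> k * r + (1 - \<alpha> k) * norm (T (xs k) - p)"
      unfolding split r_def by (rule norm_triangle_le) (use \<alpha>01[of k] in simp)
    also have "\<dots> \<le> \<alpha> k * r + (1 - \<alpha> k) * r"
      using fejer[OF \<open>p \<in> S\<close>, of "xs k"] Suc \<alpha>01[of k]
      by (intro add_left_mono mult_left_mono) auto
    finally show ?case by (simp add: algebra_simps)
  qed
  then have in_ball: "xs k \<in> cball p r" for k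
    by (simp add: dist_norm norm_minus_commute)
  have step: "(norm (xs (Suc k) - p))\<^sup>2
      \<le> (1 - \<alpha> k) * ((norm (xs k - p))\<^sup>2 - c\<^sub>0 * (\<delta> k)\<^sup>2)
        + \<alpha> k * (\<alpha> k * r\<^sup>2 + 2 * (1 - \<alpha> k) * (r * infdist (xs k) S))" for k
  proof -
    let ?w = "T (xs k) - p"
    have "(norm (xs (Suc k) - p))\<^sup>2
        = (1 - \<alpha> k) * ((1 - \<alpha> k) * (norm ?w)\<^sup>2)
          + \<alpha> k * (\<alpha> k * r\<^sup>2 + 2 * (1 - \<alpha> k) * ((x - p) \<bullet> ?w))"
      unfolding split r_def power2_norm_eq_inner
      by (simp add: inner_add_left inner_add_right inner_commute power2_eq_square) algebra
    also have "\<dots> \<le> (1 - \<alpha> k) * (1 * ((norm (xs k - p))\<^sup>2 - c\<^sub>0 * (\<delta> k)\<^sup>2))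
          + \<alpha> k * (\<alpha> k * r\<^sup>2 + 2 * (1 - \<alpha> k) * (r * infdist (xs k) S))"
    proof (intro add_mono mult_left_mono order_refl)
      have "(1 - \<alpha> k) * (norm ?w)\<^sup>2 \<le> 1 * (norm ?w)\<^sup>2"
        using \<alpha>01[of k] by (intro mult_right_mono) auto
      then show "(1 - \<alpha> k) * (norm ?w)\<^sup>2 \<le> 1 * ((norm (xs k - p))\<^sup>2 - c\<^sub>0 * (\<delta> k)\<^sup>2)"
        using fejer2[OF \<open>p \<in> S\<close>, of "xs k"] by (simp add: \<delta>_def)
      show "(x - p) \<bullet> ?w \<le> r * infdist (xs k) S"
        unfolding p_def r_def
        by (rule inner_closest_point_le_infdist[OF \<open>closed S\<close> \<open>convex S\<close> \<open>S \<noteq> {}\<close> fejer])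
    qed (use \<alpha>01[of k] in auto)
    finally show ?thesis by simp
  qed
  have small: "\<forall>\<^sub>F k in sequentially. (norm (xs k - p))\<^sup>2 < \<eta>" if "0 < \<eta>" for \<eta>
  proof -
    \<comment> \<open>The error terms \<open>r\<^sup>2 * \<alpha> k\<close> and \<open>2 * r * \<epsilon>\<close> must total at most \<open>\<eta> / 2\<close>; the summand 1 covers
      \<open>r = 0\<close>.\<close>
    define \<epsilon> where "\<epsilon> = \<eta> / (8 * (r + 1))"
    have "0 \<le> r" by (simp add: r_def)
    then have "0 < \<epsilon>" using that by (simp add: \<epsilon>_def)
    have "2 * r * \<epsilon> \<le> \<eta> / 4"
      using \<open>0 \<le> r\<close> \<open>0 < \<eta>\<close> by (simp add: \<epsilon>_def field_simps)
    obtain K where "0 \<le> K"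
      and K: "\<And>k. infdist (xs k) S \<le> \<epsilon> + K * (\<delta> k)\<^sup>2"
      using infdist_Inter_le_max_violation_square[OF assms(2,4,5) bounded_cball \<open>0 < \<epsilon>\<close>] in_ball
      unfolding \<delta>_def by metis
    have "(\<lambda>k. 2 * r * K * \<alpha> k) \<longlonglongrightarrow> 0" and "(\<lambda>k. r\<^sup>2 * \<alpha> k) \<longlonglongrightarrow> 0"
      using assms(9) by (auto intro: tendsto_mult_right_zero)
    then have "\<forall>\<^sub>F k in sequentially. 2 * r * K * \<alpha> k < c\<^sub>0"
      and "\<forall>\<^sub>F k in sequentially. r\<^sup>2 * \<alpha> k < \<eta> / 4"
      using \<open>0 < \<eta>\<close> assms(6) by (auto intro: order_tendstoD(2) simp del: less_divide_eq_numeral1)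
    then have "\<forall>\<^sub>F k in sequentially. (norm (xs (Suc k) - p))\<^sup>2
        \<le> (1 - \<alpha> k) * (norm (xs k - p))\<^sup>2 + \<alpha> k * (\<eta> / 2)"
    proof eventually_elim
      case (elim k)
      let ?e = "1 - \<alpha> k"
      have "\<alpha> k * (\<alpha> k * r\<^sup>2 + 2 * ?e * (r * infdist (xs k) S))
          \<le> \<alpha> k * (\<alpha> k * r\<^sup>2 + 2 * ?e * (r * (\<epsilon> + K * (\<delta> k)\<^sup>2)))"
        using \<alpha>01[of k] K \<open>0 \<le> r\<close> by (intro mult_left_mono add_left_mono) auto
      also have "\<dots> = \<alpha> k * (r\<^sup>2 * \<alpha> k + ?e * (2 * r * \<epsilon>)) + ?e * (2 * r * K * \<alpha> k * (\<delta> k)\<^sup>2)"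
        by (simp add: algebra_simps)
      \<comment> \<open>Once \<open>2 * r * K * \<alpha> k < c\<^sub>0\<close>, the last term is at most the decrease guaranteed by \<open>T\<close>.\<close>
      also have "\<dots> \<le> \<alpha> k * (\<eta> / 4 + 1 * (\<eta> / 4)) + ?e * (c\<^sub>0 * (\<delta> k)\<^sup>2)"
        using elim \<alpha>01[of k] \<open>2 * r * \<epsilon> \<le> \<eta> / 4\<close> \<open>0 \<le> r\<close> \<open>0 < \<epsilon>\<close>
        by (intro add_mono mult_left_mono mult_mono mult_right_mono) auto
      finally show ?case
        using step[of k] by (simp add: algebra_simps)
    qed
    then show ?thesis
      by (rule contracting_recursion_eventually_small
          [OF assms(8,10), where u = "\<lambda>k. (norm (xs k - p))\<^sup>2"])
        (use \<open>0 < \<eta>\<close> in auto)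
  qed
  have "xs \<longlonglongrightarrow> p"
  proof (rule tendstoI)
    fix e :: real assume "0 < e"
    then have "\<forall>\<^sub>F k in sequentially. (norm (xs k - p))\<^sup>2 < e\<^sup>2"
      by (intro small) simp
    then show "\<forall>\<^sub>F k in sequentially. dist (xs k) p < e"
      by eventually_elim (use \<open>0 < e\<close> power2_less_imp_less in \<open>force simp: dist_norm\<close>)
  qed
  then show ?thesis by (simp add: p_def)
qed

end
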